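(* Every finite non-trivial solvable group $G$ admits a uniform cyclic group factorization; that is, there exist $k\ge 1$ and cyclic subgroups $H_1,H_2,\ldots,H_k$ of $G$ such that $(H_1,H_2,\ldots,H_k)$ is a uniform cyclic group factorization of $G$. In particular, every finite non-trivial abelian group admits a uniform cyclic group factorization.
   Context: Let $G$ be a finite group and $\mathcal{H}=(H_1,H_2,\ldots,H_k)$, $k\ge 1$, an ordered tuple of subsets of $G$. The multiplication map $\mathrm{mult}_{\mathcal{H}}:H_1\times H_2\times\cdots\times H_k\to G$ is defined by $\mathrm{mult}_{\mathcal{H}}(h_1,h_2,\ldots,h_k)=h_1h_2\cdots h_k$. The tuple $\mathcal{H}$ is a factorization of $G$ if $\mathrm{mult}_{\mathcal{H}}$ is surjective. A factorization $\mathcal{H}$ is a uniform factorization of $G$ if $|\mathrm{mult}_{\mathcal{H}}^{-1}(g)|$ does not depend on $g\in G$; this common value is called its multiplicity. A uniform factorization is a uniform group factorization if all $H_i$ are subgroups of $G$, and a uniform cyclic group factorization if all $H_i$ are cyclic subgroups of $G$. The length $k$ and the multiplicity may be arbitrary positive integers. *)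

theory Defs
  imports "HOL-Algebra.Algebra"
begin

text \<open>
  A tuple \<open>(H\<^sub>1, \<dots>, H\<^sub>k)\<close> of subsets of \<open>G\<close> is a list of sets; its Cartesian product
  \<open>H\<^sub>1 \<times> \<dots> \<times> H\<^sub>k\<close> is the library's \<^const>\<open>listset\<close>, whose elements are the lists
  \<open>[h\<^sub>1, \<dots>, h\<^sub>k]\<close> with \<open>h\<^sub>i \<in> H\<^sub>i\<close>.
\<close>

definition tuple_mult :: "('a, 'b) monoid_scheme \<Rightarrow> 'a list \<Rightarrow> 'a"
  where "tuple_mult G hs = foldr (\<otimes>\<^bsub>G\<^esub>) hs \<one>\<^bsub>G\<^esub>"

definition is_factorization :: "('a, 'b) monoid_scheme \<Rightarrow> 'a set list \<Rightarrow> bool"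
  where "is_factorization G Hs \<longleftrightarrow>
    Hs \<noteq> [] \<and> (\<forall>H \<in> set Hs. H \<subseteq> carrier G) \<and> tuple_mult G ` listset Hs = carrier G"

text \<open>
  The witness \<open>m\<close> below is the multiplicity. The definition is meant for finite groups only:
  \<^const>\<open>card\<close> is \<open>0\<close> on infinite fibres.
\<close>

definition uniform_factorization :: "('a, 'b) monoid_scheme \<Rightarrow> 'a set list \<Rightarrow> bool"
  where "uniform_factorization G Hs \<longleftrightarrow>
    is_factorization G Hs \<and>
    (\<exists>m. \<forall>g \<in> carrier G. card {hs \<in> listset Hs. tuple_mult G hs = g} = m)"

definition uniform_group_factorization :: "('a, 'b) monoid_scheme \<Rightarrow> 'a set list \<Rightarrow> bool"
  where "uniform_group_factorization G Hs \<longleftrightarrow>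
    uniform_factorization G Hs \<and> (\<forall>H \<in> set Hs. subgroup H G)"

definition uniform_cyclic_group_factorization :: "('a, 'b) monoid_scheme \<Rightarrow> 'a set list \<Rightarrow> bool"
  where "uniform_cyclic_group_factorization G Hs \<longleftrightarrow>
    uniform_group_factorization G Hs \<and>
    (\<forall>H \<in> set Hs. cyclic_group (G\<lparr>carrier := H\<rparr>))"

end

theory Submission
  imports Defs
begin

text \<open>
  The proof builds a factorization of \<open>G\<close> by prepending one cyclic subgroup at a time.
  If a subgroup \<open>L\<close> is the uniform product of a tuple with multiplicity \<open>m\<close>, and \<open>C\<close> is any
  subgroup, then the set \<open>C L\<close> is the uniform product of the tuple with \<open>C\<close> put in front: for
  \<open>g \<in> C L\<close> the elements \<open>c \<in> C\<close> with \<open>c\<^sup>-\<^sup>1 g \<in> L\<close> form a left coset of \<open>C \<inter> L\<close>, and each of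
  them contributes the \<open>m\<close> representations of \<open>c\<^sup>-\<^sup>1 g\<close>, so that the new multiplicity is
  \<open>\<bar>C \<inter> L\<bar> m\<close> (lemma \<open>uniform_product_Cons\<close>). Normality is needed only to make \<open>C L\<close> a
  subgroup again, so that the step can be repeated.

  Let \<open>G\<close> be solvable and let \<open>K\<close> be normal in a subgroup \<open>H\<close> with \<open>H / K\<close> abelian. Every subgroup
  \<open>L\<close> with \<open>K \<subseteq> L \<subseteq> H\<close> contains the commutators of \<open>H\<close> and is therefore normal in \<open>H\<close>. If \<open>K\<close> is
  a uniform product of cyclic subgroups, then a maximal such \<open>L\<close> that is one equals \<open>H\<close>: otherwise,
  for \<open>x \<in> H - L\<close>, the larger subgroup \<open>\<langle>x\<rangle> L\<close> is one as well. Climbing up a subnormal series with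
  abelian quotients, from the empty tuple for the trivial subgroup, reaches \<open>G\<close>.
\<close>

section \<open>Uniform products\<close>

text \<open>
  The set \<open>S\<close> is the uniform product of the tuple \<open>Hs\<close> with multiplicity \<open>m\<close>. In contrast to a
  factorization, the product need not be the whole group, and the tuple may be empty.
\<close>

definition uniform_product :: "('a, 'b) monoid_scheme \<Rightarrow> 'a set list \<Rightarrow> 'a set \<Rightarrow> nat \<Rightarrow> bool"
  where "uniform_product G Hs S m \<longleftrightarrow>
    tuple_mult G ` listset Hs = S \<and>
    (\<forall>g \<in> S. card {hs \<in> listset Hs. tuple_mult G hs = g} = m)"

lemma tuple_mult_Nil [simp]: "tuple_mult G [] = \<one>\<^bsub>G\<^esub>"
  by (simp add: tuple_mult_def)

lemma tuple_mult_Cons [simp]: "tuple_mult G (h # hs) = h \<otimes>\<^bsub>G\<^esub> tuple_mult G hs"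
  by (simp add: tuple_mult_def)

lemma finite_listset: "\<forall>H \<in> set Hs. finite H \<Longrightarrow> finite (listset Hs)"
proof (induction Hs)
  case (Cons H Hs)
  have "set_Cons H (listset Hs) = (\<lambda>(h, hs). h # hs) ` (H \<times> listset Hs)"
    by (auto simp: set_Cons_def)
  with Cons show ?case by simp
qed simp

lemma (in group) inv_mult_cancel:
  assumes "x \<in> carrier G" "y \<in> carrier G"
  shows "inv x \<otimes> (x \<otimes> y) = y" and "x \<otimes> (inv x \<otimes> y) = y"
  using assms by (simp_all flip: m_assoc)

lemma (in group) card_left_quotients:
  assumes C: "subgroup C G" and L: "subgroup L G" and g: "g \<in> C <#> L"
  shows "card {c \<in> C. inv c \<otimes> g \<in> L} = card (C \<inter> L)"
proof -
  interpret C: subgroup C G by fact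
  interpret L: subgroup L G by fact
  obtain c0 l0 where c0: "c0 \<in> C" and l0: "l0 \<in> L" and g_eq: "g = c0 \<otimes> l0"
    using g by (auto simp: set_mult_def)
  have iff: "inv (c0 \<otimes> d) \<otimes> g \<in> L \<longleftrightarrow> d \<in> L" if d: "d \<in> C" for d
  proof -
    have "inv (c0 \<otimes> d) \<otimes> g = inv d \<otimes> l0"
      using c0 l0 d by (simp add: g_eq inv_mult_group m_assoc inv_mult_cancel)
    also have "\<dots> \<in> L \<longleftrightarrow> d \<in> L"
    proof
      assume "inv d \<otimes> l0 \<in> L"
      then have "l0 \<otimes> inv (inv d \<otimes> l0) \<in> L" using l0 by blast
      also have "l0 \<otimes> inv (inv d \<otimes> l0) = d"
        using l0 d by (simp add: inv_mult_group flip: m_assoc)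
      finally show "d \<in> L" .
    qed (use l0 in blast)
    finally show ?thesis .
  qed
  have "bij_betw (\<lambda>d. c0 \<otimes> d) (C \<inter> L) {c \<in> C. inv c \<otimes> g \<in> L}"
  proof (rule bij_betwI')
    fix c assume c: "c \<in> {c \<in> C. inv c \<otimes> g \<in> L}"
    have eq: "c = c0 \<otimes> (inv c0 \<otimes> c)"
      using c c0 by (simp flip: m_assoc)
    have mem: "inv c0 \<otimes> c \<in> C" using c c0 by blast
    have "inv c0 \<otimes> c \<in> L"
      using c iff[OF mem] by (simp flip: eq)
    with eq mem show "\<exists>d \<in> C \<inter> L. c = c0 \<otimes> d" by blast
  qed (use c0 iff in auto)
  then show ?thesis by (simp add: bij_betw_same_card)
qed

lemma (in group) uniform_product_Cons:
  assumes C: "subgroup C G" and L: "subgroup L G"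
    and fin: "finite C" "\<forall>H \<in> set Hs. finite H"
    and Hs: "uniform_product G Hs L m"
  shows "uniform_product G (C # Hs) (C <#> L) (card (C \<inter> L) * m)"
proof -
  interpret C: subgroup C G by fact
  interpret L: subgroup L G by fact
  let ?fib = "\<lambda>g. {hs \<in> listset Hs. tuple_mult G hs = g}"
  have img: "tuple_mult G ` listset Hs = L" and card_fib: "\<And>g. g \<in> L \<Longrightarrow> card (?fib g) = m"
    using Hs by (auto simp: uniform_product_def)
  have in_L: "tuple_mult G hs \<in> L" if "hs \<in> listset Hs" for hs
    using img that by blast
  have "tuple_mult G ` listset (C # Hs) = C <#> tuple_mult G ` listset Hs"
    by (auto simp: set_Cons_def set_mult_def image_iff) (metis tuple_mult_Cons)+
  moreover have "card {hs \<in> listset (C # Hs). tuple_mult G hs = g} = card (C \<inter> L) * m"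
    if g: "g \<in> C <#> L" for g
  proof -
    have gG: "g \<in> carrier G"
      using g by (auto simp: set_mult_def)
    define Q where "Q = {c \<in> C. inv c \<otimes> g \<in> L}"
    have solve: "c \<otimes> tuple_mult G hs = g \<longleftrightarrow> tuple_mult G hs = inv c \<otimes> g"
      if "c \<in> C" "hs \<in> listset Hs" for c hs
      using that in_L[OF that(2)] gG by (metis C.mem_carrier L.mem_carrier inv_solve_left)
    have "{hs \<in> listset (C # Hs). tuple_mult G hs = g} =
        (\<lambda>(c, hs). c # hs) ` (SIGMA c:Q. ?fib (inv c \<otimes> g))"
      using in_L solve by (fastforce simp: Q_def set_Cons_def)
    moreover have "inj_on (\<lambda>(c, hs). c # hs) (SIGMA c:Q. ?fib (inv c \<otimes> g))"
      by (auto simp: inj_on_def)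
    ultimately have "card {hs \<in> listset (C # Hs). tuple_mult G hs = g} =
        card (SIGMA c:Q. ?fib (inv c \<otimes> g))"
      by (simp add: card_image)
    also have "\<dots> = (\<Sum>c\<in>Q. card (?fib (inv c \<otimes> g)))"
      using fin finite_listset[OF fin(2)] by (intro card_SigmaI) (auto simp: Q_def)
    also have "\<dots> = card Q * m"
      by (simp add: Q_def card_fib)
    also have "card Q = card (C \<inter> L)"
      unfolding Q_def by (rule card_left_quotients[OF C L g])
    finally show ?thesis .
  qed
  ultimately show ?thesis
    by (simp add: uniform_product_def img)
qed

section \<open>Products of cyclic subgroups in solvable groups\<close>

text \<open>
  The subset \<open>S\<close> is a uniform product of subgroups generated by one element. The empty
  tuple is admitted, so that the trivial subgroup qualifies.
\<close>

definition uniform_cyclic_product :: "('a, 'b) monoid_scheme \<Rightarrow> 'a set \<Rightarrow> bool"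
  where "uniform_cyclic_product G S \<longleftrightarrow>
    (\<exists>Hs m. (\<forall>H \<in> set Hs. \<exists>x \<in> carrier G. H = generate G {x}) \<and> uniform_product G Hs S m)"

lemma (in group) uniform_cyclic_product_one: "uniform_cyclic_product G {\<one>}"
proof -
  have "{hs. hs = [] \<and> tuple_mult G hs = \<one>} = {[]}"
    by auto
  then have "uniform_product G [] {\<one>} 1"
    by (simp add: uniform_product_def)
  then show ?thesis
    unfolding uniform_cyclic_product_def by (metis empty_iff empty_set)
qed

lemma (in group) uniform_cyclic_product_generate_mult:
  assumes fin: "finite (carrier G)" and x: "x \<in> carrier G"
    and L: "subgroup L G" "uniform_cyclic_product G L"
  shows "uniform_cyclic_product G (generate G {x} <#> L)"
proof -
  obtain Hs m where Hs: "\<forall>H \<in> set Hs. \<exists>y \<in> carrier G. H = generate G {y}"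
    and prod: "uniform_product G Hs L m"
    using L(2) by (auto simp: uniform_cyclic_product_def)
  have fin_gen: "finite (generate G {y})" if "y \<in> carrier G" for y
    using that fin by (intro finite_subset[OF generate_incl]) auto
  have "subgroup (generate G {x}) G"
    using x by (intro generate_is_subgroup) auto
  then have "uniform_product G (generate G {x} # Hs) (generate G {x} <#> L)
      (card (generate G {x} \<inter> L) * m)"
    using Hs x fin_gen by (intro uniform_product_Cons L prod) auto
  moreover have "\<forall>H \<in> set (generate G {x} # Hs). \<exists>y \<in> carrier G. H = generate G {y}"
    using Hs x by auto
  ultimately show ?thesis
    unfolding uniform_cyclic_product_def by blast
qed

text \<open>
  A subgroup \<open>L\<close> of \<open>H\<close> that contains the commutators of \<open>H\<close> is normalized by \<open>H\<close>, because
  \<open>c l c\<^sup>-\<^sup>1 = [c, l] l\<close>.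
\<close>

lemma (in group) subgroup_set_mult_above_derived:
  assumes H: "subgroup H G" and C: "subgroup C G" "C \<subseteq> H"
    and L: "subgroup L G" "L \<subseteq> H" "derived G H \<subseteq> L"
  shows "subgroup (C <#> L) G"
proof -
  interpret H: subgroup H G by fact
  interpret C: subgroup C G by fact
  interpret L: subgroup L G by fact
  have conj: "c \<otimes> l \<otimes> inv c \<in> L" if c: "c \<in> H" and l: "l \<in> L" for c l
  proof -
    have lH: "l \<in> H" using l L(2) by blast
    have "c \<otimes> l \<otimes> inv c \<otimes> inv l \<in> derived G H"
      unfolding derived_def by (rule generate.incl) (use c lH in auto)
    then have "(c \<otimes> l \<otimes> inv c \<otimes> inv l) \<otimes> l \<in> L"
      using L(3) l by blast
    then show ?thesis
      using c lH by (simp add: m_assoc)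
  qed
  show ?thesis
  proof (rule subgroupI)
    show "C <#> L \<subseteq> carrier G"
      by (rule set_mult_closed[OF C.subset L.subset])
    show "C <#> L \<noteq> {}"
      using C.one_closed L.one_closed unfolding set_mult_def by blast
  next
    fix a assume "a \<in> C <#> L"
    then obtain c l where c: "c \<in> C" and l: "l \<in> L" and a: "a = c \<otimes> l"
      by (auto simp: set_mult_def)
    have "inv a = inv c \<otimes> (c \<otimes> inv l \<otimes> inv c)"
      using c l by (simp add: a inv_mult_group m_assoc inv_mult_cancel)
    moreover have "c \<otimes> inv l \<otimes> inv c \<in> L"
      using conj[of c "inv l"] c l C(2) by blast
    ultimately show "inv a \<in> C <#> L"
      using c unfolding set_mult_def by blast
  next
    fix a b assume "a \<in> C <#> L" "b \<in> C <#> L"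
    then obtain c l d k where cd: "c \<in> C" "d \<in> C" and lk: "l \<in> L" "k \<in> L"
      and ab: "a = c \<otimes> l" "b = d \<otimes> k"
      by (auto simp: set_mult_def)
    have "a \<otimes> b = (c \<otimes> d) \<otimes> ((inv d \<otimes> l \<otimes> inv (inv d)) \<otimes> k)"
      using cd lk by (simp add: ab m_assoc inv_mult_cancel)
    moreover have "inv d \<otimes> l \<otimes> inv (inv d) \<in> L"
      using conj[of "inv d" l] cd lk C(2) by blast
    ultimately show "a \<otimes> b \<in> C <#> L"
      using cd lk unfolding set_mult_def by blast
  qed
qed

lemma (in group) uniform_cyclic_product_above_derived:
  assumes fin: "finite (carrier G)" and H: "subgroup H G"
    and K: "subgroup K G" "K \<subseteq> H" "derived G H \<subseteq> K" "uniform_cyclic_product G K"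
  shows "uniform_cyclic_product G H"
proof -
  interpret H: subgroup H G by fact
  define \<L> where
    "\<L> = {L. subgroup L G \<and> L \<subseteq> H \<and> derived G H \<subseteq> L \<and> uniform_cyclic_product G L}"
  have "finite \<L>"
    using fin H.subset by (intro finite_subset[of \<L> "Pow H"]) (auto simp: \<L>_def finite_subset)
  moreover have "K \<in> \<L>"
    using K by (simp add: \<L>_def)
  ultimately obtain L where "L \<in> \<L>" and max: "\<And>M. M \<in> \<L> \<Longrightarrow> L \<subseteq> M \<Longrightarrow> L = M"
    using finite_has_maximal[of \<L>] by blast
  then have L: "subgroup L G" "L \<subseteq> H" "derived G H \<subseteq> L" "uniform_cyclic_product G L"
    by (auto simp: \<L>_def)
  interpret L: subgroup L G by fact
  have "H \<subseteq> L"
  proof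
    fix x assume x: "x \<in> H"
    let ?C = "generate G {x}"
    have C: "subgroup ?C G" "?C \<subseteq> H"
      using x H by (auto intro!: generate_is_subgroup generate_subgroup_incl del: subsetI)
    interpret C: subgroup ?C G by (rule C(1))
    have LM: "L \<subseteq> ?C <#> L"
    proof
      fix l assume l: "l \<in> L"
      then have "\<one> \<otimes> l \<in> ?C <#> L"
        using C.one_closed unfolding set_mult_def by blast
      with l show "l \<in> ?C <#> L" by simp
    qed
    have "subgroup (?C <#> L) G"
      by (rule subgroup_set_mult_above_derived[OF H C L(1-3)])
    moreover have "?C <#> L \<subseteq> H"
      using C(2) L(2) by (auto simp: set_mult_def)
    moreover have "uniform_cyclic_product G (?C <#> L)"
      using x by (intro uniform_cyclic_product_generate_mult fin L) auto
    ultimately have "?C <#> L \<in> \<L>"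
      using L(3) LM by (auto simp: \<L>_def)
    then have "L = ?C <#> L"
      using max LM by blast
    moreover have "x \<otimes> \<one> \<in> ?C <#> L"
      unfolding set_mult_def using generate.incl[of x "{x}" G] L.one_closed by blast
    ultimately show "x \<in> L"
      using x by simp
  qed
  with L show ?thesis by auto
qed

lemma (in group) solvable_seq_imp_uniform_cyclic_product:
  assumes fin: "finite (carrier G)" and "solvable_seq G H"
  shows "uniform_cyclic_product G H"
  using assms(2)
proof induction
  case unity
  show ?case by (rule uniform_cyclic_product_one)
next
  case (extension K H)
  have "K \<subseteq> H"
    using normal_imp_subgroup[OF extension.hyps(2)] subgroup.subset by fastforce
  moreover have "derived G H \<subseteq> K"
    by (rule derived_of_subgroup_minimal[OF extension.hyps(2-4)])
  ultimately show ?case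
    using uniform_cyclic_product_above_derived[OF fin extension.hyps(3)
        solvable_imp_subgroup[OF extension.hyps(1)]] extension.IH
    by blast
qed

section \<open>Uniform cyclic group factorizations\<close>

text \<open>
  Since the group is non-trivial, the tuple is not the empty one, whose product is the trivial
  subgroup.
\<close>

lemma (in group) uniform_cyclic_product_imp_factorization:
  assumes nontriv: "\<not> trivial_group G" and prod: "uniform_cyclic_product G (carrier G)"
  shows "\<exists>Hs. uniform_cyclic_group_factorization G Hs"
proof -
  obtain Hs m where Hs: "\<forall>H \<in> set Hs. \<exists>x \<in> carrier G. H = generate G {x}"
    and m: "uniform_product G Hs (carrier G) m"
    using prod by (auto simp: uniform_cyclic_product_def)
  have "Hs \<noteq> []"
    using m nontriv trivial_group_subset by (auto simp: uniform_product_def)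
  moreover have sub: "subgroup H G" if "H \<in> set Hs" for H
    using that Hs by (auto intro: generate_is_subgroup)
  moreover have "cyclic_group (G\<lparr>carrier := H\<rparr>)" if H: "H \<in> set Hs" for H
  proof -
    obtain x where "x \<in> carrier G" "H = generate G {x}"
      using bspec[OF Hs H] ..
    then show ?thesis
      using cyclic_group_generated[of x] by (simp add: subgroup_generated_def)
  qed
  ultimately have "uniform_cyclic_group_factorization G Hs"
    using m unfolding uniform_cyclic_group_factorization_def uniform_group_factorization_def
      uniform_factorization_def is_factorization_def uniform_product_def
    by (blast dest: subgroup.subset)
  then show ?thesis ..
qed

lemma (in comm_group) solvable: "solvable G"
proof -
  have "(derived G ^^ 1) (carrier G) = {\<one>}"
    by (simp add: derived_eq_singleton)
  then show ?thesis
    unfolding solvable_iff_trivial_derived_seq ..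
qed

theorem theorem1p2:
  fixes G :: "('a, 'b) monoid_scheme"
  assumes "group G" and "finite (carrier G)" and "\<not> trivial_group G"
  shows "(solvable G \<longrightarrow> (\<exists>Hs. uniform_cyclic_group_factorization G Hs)) \<and>
         (comm_group G \<longrightarrow> (\<exists>Hs. uniform_cyclic_group_factorization G Hs))"
proof -
  interpret group G by fact
  have "\<exists>Hs. uniform_cyclic_group_factorization G Hs" if "solvable G"
    using that assms(2,3) unfolding solvable_def
    by (intro uniform_cyclic_product_imp_factorization solvable_seq_imp_uniform_cyclic_product)
  then show ?thesis
    using comm_group.solvable by blast
qed

end
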